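(* Let $0<R_0<+\infty$ and let $m:[R_0,+\infty)\to\mathbb R$ be an increasing continuous function that has at every point $r\in[R_0,+\infty)$ a right derivative $m'_{\mathrm{right}}(r)$ which is right-continuous, and such that the function $r\mapsto r\,m'_{\mathrm{right}}(r)$ is increasing. Let $f\not\equiv0$ be an entire function that vanishes on a sequence $\mathtt Z=\{\mathtt z_k\}_{k=1,2,\dots}\subset\mathbb C$ and satisfies $\log|f(z)|\le m(|z|)$ for all $z\in\mathbb C$ with $|z|\ge R_0$. Then for every number $b\ge0$ there exist constants $C\ge0$, depending only on $R_0,b$, and $\overline C_m\ge0$, depending only on $R_0,b,m$, such that for every $d\in\mathrm{decr}^+[R_0,+\infty;\le b)$ $$\sum_{|\mathtt z_k|\ge R_0}\int_{|\mathtt z_k|}^{+\infty}\frac{d(t)}t\,dt\le\int_{R_0}^{+\infty}d(t)\,m'_{\mathrm{right}}(t)\,dt+C\,\overline C_m-C\log|f(0)|,$$ and the constant $\overline C_m$ is positively homogeneous and subadditive in $m$.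
   Context: Positive means $\ge0$; increasing/decreasing are non-strict. For $b\ge0$, $\mathrm{decr}^+[R_0,+\infty;\le b)$ is the class of all positive decreasing functions $d$ on $[R_d,+\infty]$, with some $R_d\in(0,R_0)$ depending on $d$, such that $\int_{R_0}^{+\infty}\frac{d(t)}t\,dt\le b$. An entire $f\not\equiv0$ vanishes on $\mathtt Z$ if at each point $z$ the multiplicity of the zero of $f$ is at least the number of repetitions of $z$ in $\mathtt Z$. If $f(0)=0$ the right-hand side is understood as $+\infty$. Positively homogeneous: $\overline C_{am}=a\overline C_m$ for $a\ge0$; subadditive: $\overline C_{m_1+m_2}\le\overline C_{m_1}+\overline C_{m_2}$. *)

theory Defs
  imports "HOL-Complex_Analysis.Complex_Analysis"
begin

definition right_deriv :: "(real \<Rightarrow> real) \<Rightarrow> real \<Rightarrow> real" where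
  "right_deriv m r = vector_derivative m (at_right r)"

text \<open>A function on \<open>[R0, +\<infinity>)\<close> is represented by a total function whose values below
  \<open>R0\<close> are irrelevant.\<close>

definition admissible_majorant :: "real \<Rightarrow> (real \<Rightarrow> real) \<Rightarrow> bool" where
  "admissible_majorant R0 m \<longleftrightarrow>
     mono_on {R0..} m \<and>
     continuous_on {R0..} m \<and>
     (\<forall>r\<ge>R0. m differentiable (at_right r)) \<and>
     (\<forall>r\<ge>R0. continuous (at_right r) (right_deriv m)) \<and>
     mono_on {R0..} (\<lambda>r. r * right_deriv m r)"

definition decr_pos :: "real \<Rightarrow> real \<Rightarrow> (ereal \<Rightarrow> real) set" where
  "decr_pos R0 b = {d. \<exists>Rd. 0 < Rd \<and> Rd < R0 \<and>
     (\<forall>t\<in>{ereal Rd..\<infinity>}. 0 \<le> d t) \<and>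
     antimono_on {ereal Rd..\<infinity>} d \<and>
     (\<integral>\<^sup>+t\<in>{R0..}. ennreal (d (ereal t) / t) \<partial>lborel) \<le> ennreal b}"

text \<open>The extended-real value of \<open>log |w|\<close>; note that \<open>ln 0 = 0\<close> in HOL.\<close>

definition log_abs :: "complex \<Rightarrow> ereal" where
  "log_abs w = (if w = 0 then -\<infinity> else ereal (ln (norm w)))"

text \<open>A sequence of length \<open>N\<close>, finite or infinite, is a function \<open>z\<close> used on these indices.\<close>

definition seq_index :: "enat \<Rightarrow> nat set" where
  "seq_index N = {k. 1 \<le> k \<and> enat k \<le> N}"

text \<open>For an entire \<open>f\<close> that is not identically zero, \<open>zorder f p\<close> is the multiplicity of the
  zero at \<open>p\<close> (and \<open>0\<close> if \<open>f p \<noteq> 0\<close>). Finiteness is required separately because \<open>card\<close> of an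
  infinite set is \<open>0\<close>.\<close>

definition vanishes_on :: "(complex \<Rightarrow> complex) \<Rightarrow> enat \<Rightarrow> (nat \<Rightarrow> complex) \<Rightarrow> bool" where
  "vanishes_on f N z \<longleftrightarrow>
     (\<forall>p. finite {k \<in> seq_index N. z k = p} \<and>
          int (card {k \<in> seq_index N. z k = p}) \<le> zorder f p)"

text \<open>Both integrands below are nonnegative, so the sum and the integral are taken in
  \<open>[0, +\<infinity>]\<close>.\<close>

definition zero_sum :: "real \<Rightarrow> enat \<Rightarrow> (nat \<Rightarrow> complex) \<Rightarrow> (ereal \<Rightarrow> real) \<Rightarrow> ennreal" where
  "zero_sum R0 N z d =
     (\<Sum>\<^sub>\<infinity>k\<in>{k \<in> seq_index N. R0 \<le> norm (z k)}.
        \<integral>\<^sup>+t\<in>{norm (z k)..}. ennreal (d (ereal t) / t) \<partial>lborel)"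

definition growth_integral :: "real \<Rightarrow> (real \<Rightarrow> real) \<Rightarrow> (ereal \<Rightarrow> real) \<Rightarrow> ennreal" where
  "growth_integral R0 m d =
     (\<integral>\<^sup>+t\<in>{R0..}. ennreal (d (ereal t) * right_deriv m t) \<partial>lborel)"

end

theory Submission
  imports Defs
begin

text \<open>
  For a finite family of zeros, a Blaschke product and the maximum principle bound the integral
  of \<open>n(t)/t\<close> up to \<open>T\<close> by \<open>m(T) - ln |f 0|\<close>, where \<open>n\<close> is the counting function; the sum over the
  zeros is the integral of \<open>d(t) n(t)/t\<close> over \<open>[R0, \<infinity>)\<close>. Since \<open>d\<close> decreases, integrating over its
  superlevel sets lets \<open>n(t)/t\<close> be replaced by the right derivative of \<open>m\<close>, at the cost of \<open>d(x)\<close> times a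
  constant, \<open>x\<close> being the left end of the range. The value \<open>d(R0)\<close> is not controlled by \<open>b\<close>, but
  \<open>d(2 R0) \<le> b / ln 2\<close> is, so this is done only on \<open>[2 R0, \<infinity>)\<close>; on \<open>[R0, 2 R0]\<close> the integral is at
  most \<open>b n(2 R0)\<close>, and \<open>n(2 R0) ln 2 \<le> m(4 R0) - ln |f 0|\<close>. This gives \<open>C = 2 b / ln 2\<close> and, as the
  constant for \<open>m\<close>, the positive part of \<open>m(4 R0)\<close>.
\<close>

section \<open>Dividing out zeros, and Jensen's inequality\<close>

text \<open>Zeros are divided out one at a time. The difference quotient at \<open>a = z k\<close>
  has a removable singularity, so it stays entire, and both the order at \<open>a\<close> and the
  number of remaining indices with value \<open>a\<close> drop by one. The multiplicity hypothesis
  therefore passes to the quotient, also for repeated values of \<open>z\<close>.\<close>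

lemma entire_factor_zeros:
  fixes f :: "complex \<Rightarrow> complex"
  assumes "finite F" "f holomorphic_on UNIV" "f w0 \<noteq> 0"
    and "\<And>p. int (card {k \<in> F. z k = p}) \<le> zorder f p"
  shows "\<exists>h. h holomorphic_on UNIV \<and> (\<forall>w. f w = (\<Prod>k\<in>F. w - z k) * h w)"
  using assms
proof (induction F arbitrary: f rule: finite_induct)
  case empty
  then show ?case by auto
next
  case (insert k F)
  define a where "a = z k"
  \<comment> \<open>By the identity theorem zeros are isolated, so \<open>zorder\<close> is a
    genuine finite order and is additive for products.\<close>
  have nz: "\<forall>\<^sub>F w in at p. f w \<noteq> 0" for p
    using non_zero_neighbour_alt[OF insert.prems(1) open_UNIV connected_UNIV, of p w0] insert.prems(2)
    by (auto elim: eventually_mono)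
  have freq: "\<exists>\<^sub>F w in at p. f w \<noteq> 0" for p
    using nz by (simp add: eventually_frequently)
  have "0 < card {j \<in> insert k F. z j = a}"
    using insert.hyps(1) by (auto simp: card_gt_0_iff a_def)
  then have "0 < zorder f a"
    using insert.prems(3)[of a] by linarith
  then have fa: "f a = 0"
    using zorder_pos_iff[OF insert.prems(1) open_UNIV _ freq] by simp
  define g where "g = (\<lambda>w. if w = a then deriv f a else (f w - f a) / (w - a))"
  have g: "g holomorphic_on UNIV"
    unfolding g_def by (rule pole_lemma_open[OF insert.prems(1) open_UNIV])
  have fg: "f w = (w - a) * g w" for w
    using fa by (simp add: g_def)
  have "g w0 \<noteq> 0"
    using fg[of w0] insert.prems(2) by auto
  moreover have "int (card {j \<in> F. z j = p}) \<le> zorder g p" for p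
  proof -
    have "zorder f p = zorder (\<lambda>w. (w - a) * g w) p"
      by (simp flip: fg)
    also have "\<dots> = zorder (\<lambda>w. w - a) p + zorder g p"
      using nz[of p] g by (intro zorder_times_analytic)
        (auto simp: fg intro!: analytic_intros holomorphic_on_imp_analytic_at)
    also have "zorder (\<lambda>w. w - a) p = (if p = a then 1 else 0)"
    proof (cases "p = a")
      case True
      have "zorder (\<lambda>w. w - a) a = 1"
        by (rule zorder_eqI[where S = UNIV and g = "\<lambda>_. 1"]) auto
      with True show ?thesis by simp
    next
      case False
      have "zorder (\<lambda>w. w - a) p = 0"
        by (rule zorder_eq_0I) (use False in \<open>auto intro!: analytic_intros\<close>)
      with False show ?thesis by simp
    qed
    finally have "zorder f p = (if p = a then 1 else 0) + zorder g p" .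
    moreover have "card {j \<in> insert k F. z j = p} = (if p = a then 1 else 0) + card {j \<in> F. z j = p}"
    proof (cases "p = a")
      case True
      then have "{j \<in> insert k F. z j = p} = insert k {j \<in> F. z j = p}"
        by (auto simp: a_def)
      then show ?thesis using insert.hyps True by simp
    next
      case False
      then have "{j \<in> insert k F. z j = p} = {j \<in> F. z j = p}"
        by (auto simp: a_def)
      then show ?thesis using False by simp
    qed
    ultimately show ?thesis
      using insert.prems(3)[of p] by (auto split: if_splits)
  qed
  ultimately obtain h where h: "h holomorphic_on UNIV" "\<And>w. g w = (\<Prod>k\<in>F. w - z k) * h w"
    using insert.IH[OF g] by blast
  show ?case
    using h(1) insert.hyps by (intro exI[of _ h]) (auto simp: fg h(2) a_def)
qed

text \<open>Each factor \<open>w - a\<close> is replaced by \<open>(r\<^sup>2 - cnj a * w) / r\<close>, which has the same modulus on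
  \<open>|w| = r\<close>; the maximum principle is then applied to the new function at \<open>0\<close>.\<close>

lemma jensen_inequality:
  fixes f :: "complex \<Rightarrow> complex"
  assumes F: "finite F" and f: "f holomorphic_on UNIV" "f 0 \<noteq> 0"
    and mult: "\<And>p. int (card {k \<in> F. z k = p}) \<le> zorder f p"
    and r: "0 < r" and inside: "\<And>k. k \<in> F \<Longrightarrow> norm (z k) \<le> r"
    and bound: "\<And>w. norm w = r \<Longrightarrow> norm (f w) \<le> exp M"
  shows "(\<Sum>k\<in>F. ln (r / norm (z k))) \<le> M - ln (norm (f 0))"
proof -
  obtain h where h: "h holomorphic_on UNIV" "\<And>w. f w = (\<Prod>k\<in>F. w - z k) * h w"
    using entire_factor_zeros[OF F f(1) f(2) mult] by blast
  have z0: "z k \<noteq> 0" if "k \<in> F" for k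
    using h(2)[of 0] f(2) F that by auto
  define g where "g = (\<lambda>w. (\<Prod>k\<in>F. (of_real r ^ 2 - cnj (z k) * w) / of_real r) * h w)"
  have hg: "g holomorphic_on S" for S
    unfolding g_def using r
    by (intro holomorphic_intros holomorphic_on_subset[OF h(1)]) auto
  have eq: "norm (g w) = norm (f w)" if w: "norm w = r" for w
  proof -
    have "norm ((of_real r ^ 2 - cnj a * w) / of_real r) = norm (w - a)" for a
    proof -
      have "of_real r ^ 2 = cnj w * w"
        using w complex_norm_square[of w] by (simp add: mult.commute)
      then have "of_real r ^ 2 - cnj a * w = cnj (w - a) * w"
        by (simp add: algebra_simps)
      then show ?thesis
        using w r by (simp add: norm_divide norm_mult del: complex_cnj_diff)
    qed
    then show ?thesis
      by (simp add: g_def h(2) norm_mult prod_norm [symmetric])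
  qed
  have "norm (g 0) \<le> exp M"
  proof (rule maximum_modulus_frontier[OF hg holomorphic_on_imp_continuous_on[OF hg]])
    show "norm (g w) \<le> exp M" if "w \<in> frontier (cball 0 r)" for w
      using that r eq[of w] bound[of w] by simp
  qed (use r in auto)
  \<comment> \<open>At 0 every substituted factor equals \<open>r\<close>, while the factor of
    \<open>f\<close> that it replaces has modulus \<open>norm (z k)\<close>. The ratios are the
    arguments of the logarithms in the claim.\<close>
  moreover have "norm (g 0) = norm (f 0) * (\<Prod>k\<in>F. r / norm (z k))"
  proof -
    have "norm (g 0) = (\<Prod>k\<in>F. r) * norm (h 0)"
      using r by (simp add: g_def norm_mult norm_power power2_eq_square)
    also have "(\<Prod>k\<in>F. r) = (\<Prod>k\<in>F. norm (z k) * (r / norm (z k)))"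
      using z0 by (intro prod.cong) auto
    also have "\<dots> = (\<Prod>k\<in>F. norm (z k)) * (\<Prod>k\<in>F. r / norm (z k))"
      by (rule prod.distrib)
    finally have "norm (g 0) = (\<Prod>k\<in>F. norm (z k)) * (\<Prod>k\<in>F. r / norm (z k)) * norm (h 0)" .
    moreover have "norm (f 0) = (\<Prod>k\<in>F. norm (z k)) * norm (h 0)"
      by (simp add: h(2) norm_mult prod_norm [symmetric])
    ultimately show ?thesis by simp
  qed
  moreover have pos: "0 < (\<Prod>k\<in>F. r / norm (z k))"
    using r z0 by (intro prod_pos) auto
  ultimately have "ln (norm (f 0) * (\<Prod>k\<in>F. r / norm (z k))) \<le> ln (exp M)"
    using f(2) by (intro ln_mono) auto
  moreover have "ln (\<Prod>k\<in>F. r / norm (z k)) = (\<Sum>k\<in>F. ln (r / norm (z k)))"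
    using r z0 by (intro ln_prod[OF F]) auto
  ultimately show ?thesis
    using f(2) pos by (simp add: ln_mult)
qed

section \<open>Integration against a decreasing weight\<close>

text \<open>A bounded \<open>J\<close> differs from the closed interval up to its supremum at most
  in that endpoint, a null set. An unbounded \<open>J\<close> is the whole ray and is exhausted by
  the intervals \<open>{x0..x0 + real n}\<close>; since \<open>K\<close> does not depend on
  \<open>T\<close>, it survives monotone convergence.\<close>

lemma nn_integral_initial_segment_le:
  fixes a c :: "real \<Rightarrow> ennreal"
  assumes [measurable]: "a \<in> borel_measurable borel" "c \<in> borel_measurable borel"
    and le: "\<And>T. x0 \<le> T \<Longrightarrow> (\<integral>\<^sup>+t\<in>{x0..T}. a t \<partial>lborel) \<le> (\<integral>\<^sup>+t\<in>{x0..T}. c t \<partial>lborel) + K"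
    and J: "J \<subseteq> {x0..}" "J \<noteq> {}" "\<And>t u. t \<in> J \<Longrightarrow> x0 \<le> u \<Longrightarrow> u \<le> t \<Longrightarrow> u \<in> J"
  shows "(\<integral>\<^sup>+t\<in>J. a t \<partial>lborel) \<le> (\<integral>\<^sup>+t\<in>J. c t \<partial>lborel) + K"
proof (cases "bdd_above J")
  case True
  define T where "T = Sup J"
  have T: "t \<le> T" if "t \<in> J" for t
    using True that by (simp add: T_def cSup_upper)
  obtain j where "j \<in> J" using J(2) by blast
  then have "x0 \<le> T"
    using J(1) T[of j] by auto
  have mem: "t \<in> J \<longleftrightarrow> t \<in> {x0..T}" if "t \<noteq> T" for t
  proof
    show "t \<in> J \<Longrightarrow> t \<in> {x0..T}" using J(1) T by auto
    assume "t \<in> {x0..T}"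
    then have "x0 \<le> t" "t < T" using that by auto
    then obtain u where "u \<in> J" "t < u"
      using less_cSup_iff[OF J(2) True] by (auto simp: T_def)
    then show "t \<in> J" using J(3) \<open>x0 \<le> t\<close> by force
  qed
  have "(\<integral>\<^sup>+t\<in>J. h t \<partial>lborel) = (\<integral>\<^sup>+t\<in>{x0..T}. h t \<partial>lborel)" for h :: "real \<Rightarrow> ennreal"
    by (rule nn_integral_cong_AE) (use AE_lborel_singleton[of T] mem in \<open>auto simp: indicator_def\<close>)
  then show ?thesis using le[OF \<open>x0 \<le> T\<close>] by simp
next
  case False
  have "t \<in> J" if "x0 \<le> t" for t
    using False J(3) that by (meson bdd_above.I linear)
  then have J_eq: "J = {x0..}"
    using J(1) by auto
  have "(\<integral>\<^sup>+t\<in>J. a t \<partial>lborel) = (\<integral>\<^sup>+t. (SUP n. a t * indicator {x0..x0 + real n} t) \<partial>lborel)"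
  proof (rule nn_integral_cong)
    fix t
    show "a t * indicator J t = (SUP n. a t * indicator {x0..x0 + real n} t)"
    proof (rule antisym)
      obtain n where "t - x0 \<le> real n" using real_arch_simple by blast
      then have "a t * indicator J t \<le> a t * indicator {x0..x0 + real n} t"
        by (auto simp: J_eq indicator_def)
      then show "a t * indicator J t \<le> (SUP n. a t * indicator {x0..x0 + real n} t)"
        by (rule SUP_upper2[OF UNIV_I])
    qed (auto intro!: SUP_least simp: J_eq indicator_def)
  qed
  also have "\<dots> = (SUP n. \<integral>\<^sup>+t\<in>{x0..x0 + real n}. a t \<partial>lborel)"
    by (rule nn_integral_monotone_convergence_SUP)
      (auto simp: incseq_def le_fun_def indicator_def)
  also have "\<dots> \<le> (\<integral>\<^sup>+t\<in>J. c t \<partial>lborel) + K"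
  proof (rule SUP_least)
    fix n
    have "(\<integral>\<^sup>+t\<in>{x0..x0 + real n}. c t \<partial>lborel) \<le> (\<integral>\<^sup>+t\<in>J. c t \<partial>lborel)"
      by (rule nn_integral_mono) (auto simp: J_eq indicator_def)
    then show "(\<integral>\<^sup>+t\<in>{x0..x0 + real n}. a t \<partial>lborel) \<le> (\<integral>\<^sup>+t\<in>J. c t \<partial>lborel) + K"
      using le[of "x0 + real n"] by (auto intro: order_trans add_right_mono)
  qed
  finally show ?thesis .
qed

text \<open>Layer cake: the superlevel sets of a decreasing weight are initial segments of \<open>[x0, \<infinity>)\<close>.\<close>

lemma nn_integral_antimono_weight_le:
  fixes a c :: "real \<Rightarrow> ennreal" and w :: "real \<Rightarrow> real"
  assumes meas [measurable]: "a \<in> borel_measurable borel" "c \<in> borel_measurable borel"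
    and anti: "antimono_on {x0..} w" and nonneg: "\<And>t. x0 \<le> t \<Longrightarrow> 0 \<le> w t"
    and le: "\<And>T. x0 \<le> T \<Longrightarrow> (\<integral>\<^sup>+t\<in>{x0..T}. a t \<partial>lborel) \<le> (\<integral>\<^sup>+t\<in>{x0..T}. c t \<partial>lborel) + K"
  shows "(\<integral>\<^sup>+t\<in>{x0..}. ennreal (w t) * a t \<partial>lborel)
    \<le> (\<integral>\<^sup>+t\<in>{x0..}. ennreal (w t) * c t \<partial>lborel) + ennreal (w x0) * K"
proof -
  \<comment> \<open>The weight is continued to the left by its value at \<open>x0\<close>, so that
    it decreases on the whole line and is Borel for that reason.\<close>
  define W where "W t = w (max x0 t)" for t
  have W_anti: "W t \<le> W u" if "u \<le> t" for t u
    using anti that by (auto simp: W_def monotone_on_def)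
  have "mono (\<lambda>t. - W t)"
    using W_anti by (auto intro!: monoI)
  then have "(\<lambda>t. - (- W t)) \<in> borel_measurable borel"
    by (intro borel_measurable_uminus borel_measurable_mono)
  then have [measurable]: "W \<in> borel_measurable borel"
    by simp
  have W_pos: "0 \<le> W t" for t
    by (simp add: W_def nonneg)
  \<comment> \<open>The level \<open>s\<close> runs over all of the real line; the condition
    \<open>0 \<le> s\<close> makes negative levels contribute nothing.\<close>
  define L where "L s = {t. x0 \<le> t \<and> 0 \<le> s \<and> s < W t}" for s
  have layer: "(\<integral>\<^sup>+t\<in>{x0..}. ennreal (w t) * h t \<partial>lborel)
      = (\<integral>\<^sup>+s. (\<integral>\<^sup>+t\<in>L s. h t \<partial>lborel) \<partial>lborel)"
    if [measurable]: "h \<in> borel_measurable borel" for h :: "real \<Rightarrow> ennreal"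
  proof -
    have "(\<integral>\<^sup>+t\<in>{x0..}. ennreal (w t) * h t \<partial>lborel)
        = (\<integral>\<^sup>+t. (\<integral>\<^sup>+s. (if x0 \<le> t \<and> 0 \<le> s \<and> s < W t then h t else 0) \<partial>lborel) \<partial>lborel)"
    proof (rule nn_integral_cong)
      fix t
      have "(\<integral>\<^sup>+s. (if x0 \<le> t \<and> 0 \<le> s \<and> s < W t then h t else 0) \<partial>lborel)
          = (\<integral>\<^sup>+s. h t * indicator {x0..} t * indicator {0..<W t} s \<partial>lborel)"
        by (rule nn_integral_cong) (auto simp: indicator_def)
      also have "\<dots> = h t * indicator {x0..} t * ennreal (W t)"
        using W_pos[of t] by (subst nn_integral_cmult_indicator) auto
      also have "\<dots> = ennreal (w t) * h t * indicator {x0..} t"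
        by (auto simp: W_def indicator_def mult.commute max_def)
      finally show "ennreal (w t) * h t * indicator {x0..} t
          = (\<integral>\<^sup>+s. (if x0 \<le> t \<and> 0 \<le> s \<and> s < W t then h t else 0) \<partial>lborel)" ..
    qed
    also have "\<dots> = (\<integral>\<^sup>+s. (\<integral>\<^sup>+t. (if x0 \<le> t \<and> 0 \<le> s \<and> s < W t then h t else 0) \<partial>lborel) \<partial>lborel)"
      by (rule lborel_pair.Fubini') measurable
    also have "\<dots> = (\<integral>\<^sup>+s. (\<integral>\<^sup>+t\<in>L s. h t \<partial>lborel) \<partial>lborel)"
      by (intro nn_integral_cong) (auto simp: L_def indicator_def)
    finally show ?thesis .
  qed
  have [measurable]: "(\<lambda>s. \<integral>\<^sup>+t\<in>L s. c t \<partial>lborel) \<in> borel_measurable lborel"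
  proof -
    have "(\<lambda>s. \<integral>\<^sup>+t. (if x0 \<le> t \<and> 0 \<le> s \<and> s < W t then c t else 0) \<partial>lborel) \<in> borel_measurable lborel"
      by measurable
    also have "(\<lambda>s. \<integral>\<^sup>+t. (if x0 \<le> t \<and> 0 \<le> s \<and> s < W t then c t else 0) \<partial>lborel)
        = (\<lambda>s. \<integral>\<^sup>+t\<in>L s. c t \<partial>lborel)"
      by (intro ext nn_integral_cong) (auto simp: L_def indicator_def)
    finally show ?thesis .
  qed
  \<comment> \<open>For \<open>s\<close> at or above \<open>W x0\<close> the superlevel set is
    empty. Hence \<open>K\<close> is paid only on levels of total length \<open>W x0\<close>, which
    produces the term \<open>w x0 * K\<close>.\<close>
  have "(\<integral>\<^sup>+s. (\<integral>\<^sup>+t\<in>L s. a t \<partial>lborel) \<partial>lborel)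
      \<le> (\<integral>\<^sup>+s. (\<integral>\<^sup>+t\<in>L s. c t \<partial>lborel) + K * indicator {0..<W x0} s \<partial>lborel)"
  proof (rule nn_integral_mono)
    fix s
    show "(\<integral>\<^sup>+t\<in>L s. a t \<partial>lborel) \<le> (\<integral>\<^sup>+t\<in>L s. c t \<partial>lborel) + K * indicator {0..<W x0} s"
    proof (cases "0 \<le> s \<and> s < W x0")
      case True
      have "(\<integral>\<^sup>+t\<in>L s. a t \<partial>lborel) \<le> (\<integral>\<^sup>+t\<in>L s. c t \<partial>lborel) + K"
        by (rule nn_integral_initial_segment_le[OF meas le])
          (use True W_anti in \<open>auto simp: L_def intro: less_le_trans\<close>)
      then show ?thesis using True by simp
    next
      case False
      then have "L s = {}"
        using W_anti[of x0] by (force simp: L_def)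
      then show ?thesis by simp
    qed
  qed
  also have "\<dots> = (\<integral>\<^sup>+s. (\<integral>\<^sup>+t\<in>L s. c t \<partial>lborel) \<partial>lborel) + K * ennreal (W x0)"
    using W_pos[of x0] by (subst nn_integral_add) (auto simp: nn_integral_cmult_indicator)
  finally show ?thesis
    unfolding layer[OF meas(1)] layer[OF meas(2)] by (simp add: W_def mult.commute)
qed

section \<open>Right derivatives and increments of the majorant\<close>

text \<open>With only a one-sided derivative the mean value theorem is replaced by a supremum
  argument: allow a small slope \<open>e\<close> and take the last point \<open>y\<close> where the
  relaxed inequality holds. If \<open>y < b\<close>, the difference quotients just to the right of
  \<open>y\<close> are below \<open>e\<close>, so the inequality also holds beyond
  \<open>y\<close>.\<close>

lemma right_derivative_nonpos_imp_le:
  fixes \<psi> :: "real \<Rightarrow> real"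
  assumes ab: "a \<le> b" and cont: "continuous_on {a..b} \<psi>"
    and deriv: "\<And>x. a \<le> x \<Longrightarrow> x < b \<Longrightarrow> \<exists>D\<le>0. (\<psi> has_real_derivative D) (at_right x)"
  shows "\<psi> b \<le> \<psi> a"
proof (rule field_le_epsilon)
  fix e' :: real assume "0 < e'"
  \<comment> \<open>The total allowance \<open>e * (b - a)\<close> stays below \<open>e'\<close>;
    adding 1 keeps the denominator positive when \<open>a = b\<close>.\<close>
  define e where "e = e' / (b - a + 1)"
  have "0 < e" using \<open>0 < e'\<close> ab by (simp add: e_def)
  define A where "A = {x \<in> {a..b}. \<psi> x - e * (x - a) \<le> \<psi> a}"
  have cont': "continuous_on {a..b} (\<lambda>x. \<psi> x - e * (x - a))"
    by (intro continuous_intros cont)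
  have "closed A"
    unfolding A_def using continuous_closed_preimage[OF cont' closed_atLeastAtMost, of "{..\<psi> a}"]
    by (simp add: vimage_def Int_def)
  moreover have "a \<in> A" "bdd_above A"
    using ab by (auto simp: A_def bdd_above_def)
  ultimately have sup: "Sup A \<in> A"
    by (intro closed_contains_Sup) auto
  define y where "y = Sup A"
  have y: "a \<le> y" "y \<le> b" "\<psi> y - e * (y - a) \<le> \<psi> a"
    using sup by (auto simp: y_def A_def)
  have "y = b"
  proof (rule ccontr)
    assume "y \<noteq> b"
    with y have "y < b" by simp
    then obtain D where D: "D \<le> 0" "(\<psi> has_real_derivative D) (at_right y)"
      using deriv y(1) by blast
    have "((\<lambda>x. (\<psi> x - \<psi> y) / (x - y)) \<longlongrightarrow> D) (at_right y)"
      using D(2) by (simp add: has_field_derivative_iff)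
    then have "\<forall>\<^sub>F x in at_right y. (\<psi> x - \<psi> y) / (x - y) < e"
      by (rule order_tendstoD(2)) (use D(1) \<open>0 < e\<close> in auto)
    then have "\<forall>\<^sub>F x in at_right y. (\<psi> x - \<psi> y) / (x - y) < e \<and> y < x \<and> x < b"
      using eventually_at_right_less[of y] eventually_at_right_real[OF \<open>y < b\<close>]
      by eventually_elim auto
    then obtain x where x: "(\<psi> x - \<psi> y) / (x - y) < e" "y < x" "x < b"
      using eventually_happens[of _ "at_right y"] by auto
    then have "\<psi> x - \<psi> y < e * (x - y)"
      by (simp add: field_simps)
    then have "x \<in> A"
      using x y by (simp add: A_def algebra_simps)
    then have "x \<le> y"
      using \<open>bdd_above A\<close> by (simp add: y_def cSup_upper)
    then show False using x(2) by simp
  qed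
  moreover have "e * (b - a) \<le> e'"
    using \<open>0 < e'\<close> ab by (simp add: e_def divide_simps mult_left_mono)
  ultimately show "\<psi> b \<le> \<psi> a + e'"
    using y(3) by simp
qed

lemma right_deriv_works:
  assumes "m differentiable (at_right r)"
  shows "(m has_real_derivative right_deriv m r) (at_right r)"
  using assms unfolding right_deriv_def
  by (simp add: vector_derivative_works has_real_derivative_iff_has_vector_derivative)

lemma right_deriv_nonneg:
  assumes m: "admissible_majorant R0 m" and r: "R0 \<le> r"
  shows "0 \<le> right_deriv m r"
proof -
  have "(m has_real_derivative right_deriv m r) (at_right r)"
    using m r by (intro right_deriv_works) (auto simp: admissible_majorant_def)
  then have "((\<lambda>x. (m x - m r) / (x - r)) \<longlongrightarrow> right_deriv m r) (at_right r)"
    by (simp add: has_field_derivative_iff)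
  moreover have "\<forall>\<^sub>F x in at_right r. 0 \<le> (m x - m r) / (x - r)"
    using eventually_at_right_less[of r]
  proof eventually_elim
    case (elim x)
    then have "m r \<le> m x"
      using m r by (auto simp: admissible_majorant_def mono_on_def)
    then show ?case using elim by simp
  qed
  ultimately show ?thesis
    by (intro tendsto_lowerbound) auto
qed

text \<open>Only \<open>r * right_deriv m r\<close> is known to be monotone. Composed with
  \<open>max t R0\<close> it is monotone on the whole line, hence Borel, and division by the
  positive factor \<open>max t R0\<close> recovers the derivative.\<close>

lemma admissible_right_deriv_measurable:
  assumes "0 < R0" and m: "admissible_majorant R0 m"
  shows "(\<lambda>t. right_deriv m (max t R0)) \<in> borel_measurable borel"
proof -
  have "mono (\<lambda>t. max t R0 * right_deriv m (max t R0))"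
    using m by (auto simp: admissible_majorant_def mono_def
        intro!: mono_onD[where f = "\<lambda>r. r * right_deriv m r"])
  then have [measurable]: "(\<lambda>t. max t R0 * right_deriv m (max t R0)) \<in> borel_measurable borel"
    by (rule borel_measurable_mono)
  have "(\<lambda>t. max t R0 * right_deriv m (max t R0) / max t R0) \<in> borel_measurable borel"
    by measurable
  moreover have "max t R0 \<noteq> 0" for t
    using \<open>0 < R0\<close> by (auto simp: max_def)
  ultimately show ?thesis
    by simp
qed

text \<open>The half of the fundamental theorem of calculus that the estimate uses. With
  \<open>G\<close> the indefinite integral of \<open>right_deriv m\<close>, right-continuity gives
  \<open>m - G\<close> the right derivative 0, so \<open>m - G\<close> does not increase.\<close>

lemma admissible_increment_le_integral:
  assumes R0: "0 < R0" and m: "admissible_majorant R0 m" and xT: "R0 \<le> x" "x \<le> T"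
  shows "ennreal (m T - m x) \<le> (\<integral>\<^sup>+t\<in>{x..T}. ennreal (right_deriv m t) \<partial>lborel)"
proof -
  let ?g = "right_deriv m"
  have int: "?g integrable_on {x..T}"
  proof (rule measurable_bounded_by_integrable_imp_integrable)
    have "(\<lambda>t. ?g (max t R0)) \<in> borel_measurable (lebesgue_on {x..T})"
      using admissible_right_deriv_measurable[OF R0 m]
      by (simp add: measurable_completion measurable_restrict_space1)
    then show "?g \<in> borel_measurable (lebesgue_on {x..T})"
      by (rule measurable_cong[THEN iffD1, rotated]) (use xT in \<open>auto simp: max.absorb1\<close>)
    \<comment> \<open>The bound comes from
      \<open>R0 * ?g t \<le> t * ?g t \<le> T * ?g T\<close>.\<close>
    show "(\<lambda>_. T * ?g T / R0) integrable_on {x..T}"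
      by (rule integrable_const_ivl)
    fix t assume t: "t \<in> {x..T}"
    have "t * ?g t \<le> T * ?g T"
      using m xT t by (intro mono_onD[where f = "\<lambda>r. r * ?g r" and A = "{R0..}"])
        (auto simp: admissible_majorant_def)
    moreover have "R0 * ?g t \<le> t * ?g t"
      using right_deriv_nonneg[OF m] xT t by (intro mult_right_mono) auto
    ultimately show "norm (?g t) \<le> T * ?g T / R0"
      using right_deriv_nonneg[OF m, of t] xT t R0 by (simp add: pos_le_divide_eq mult.commute)
  qed auto
  define G where "G y = integral {x..y} ?g" for y
  have "m T - G T \<le> m x - G x"
  proof (rule right_derivative_nonpos_imp_le[OF xT(2)])
    show "continuous_on {x..T} (\<lambda>y. m y - G y)"
      unfolding G_def using m xT
      by (intro continuous_intros indefinite_integral_continuous_1[OF int])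
        (auto simp: admissible_majorant_def intro: continuous_on_subset)
    fix y assume y: "x \<le> y" "y < T"
    have "(m has_real_derivative ?g y) (at_right y)"
      using m xT y by (intro right_deriv_works) (auto simp: admissible_majorant_def)
    moreover have "(G has_real_derivative ?g y) (at_right y)"
    proof -
      \<comment> \<open>Continuity is available from the right only, so the integral is restarted at
        \<open>y\<close>: relative to \<open>{y..T}\<close>, right-continuity at \<open>y\<close> is
        continuity. The constant \<open>G y\<close> is added back afterwards.\<close>
      have inty: "?g integrable_on {y..T}"
        using int by (rule integrable_on_subinterval) (use y in auto)
      have "continuous (at y within {y..T}) ?g"
        using m xT y by (auto simp: admissible_majorant_def at_within_Icc_at_right)
      then have "((\<lambda>u. integral {y..u} ?g) has_vector_derivative ?g y) (at y within {y..T})"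
        using integral_has_vector_derivative_continuous_at[OF inty, of y "{}"] y by simp
      then have "((\<lambda>u. integral {y..u} ?g) has_real_derivative ?g y) (at y within {y..T})"
        by (simp add: has_real_derivative_iff_has_vector_derivative)
      then have "((\<lambda>u. G y + integral {y..u} ?g) has_real_derivative ?g y) (at y within {y..T})"
        by (auto intro!: derivative_eq_intros)
      moreover have "G y + integral {y..u} ?g = G u" if "u \<in> {y..T}" for u
        unfolding G_def using that y
        by (intro Henstock_Kurzweil_Integration.integral_combine integrable_on_subinterval[OF int]) auto
      ultimately have "(G has_real_derivative ?g y) (at y within {y..T})"
        using y by (auto elim!: has_field_derivative_transform_within[OF _ zero_less_one])
      then show ?thesis
        using y by (simp add: at_within_Icc_at_right)
    qed
    ultimately have "((\<lambda>y. m y - G y) has_real_derivative 0) (at_right y)"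
      by (auto intro!: derivative_eq_intros)
    then show "\<exists>D\<le>0. ((\<lambda>y. m y - G y) has_real_derivative D) (at_right y)"
      by auto
  qed
  then have "m T - m x \<le> G T"
    by (simp add: G_def)
  moreover have "(\<integral>\<^sup>+t\<in>{x..T}. ennreal (?g t) \<partial>lborel) = ennreal (G T)"
    unfolding G_def using right_deriv_nonneg[OF m] xT
    by (intro nn_integral_has_integral_lebesgue' integrable_integral int) auto
  ultimately show ?thesis
    by (simp add: ennreal_leI)
qed

section \<open>Logarithmic integrals\<close>

lemma nn_integral_inverse_Icc:
  assumes "0 < x" "x \<le> y"
  shows "(\<integral>\<^sup>+t\<in>{x..y}. ennreal (1 / t) \<partial>lborel) = ennreal (ln (y / x))"
proof -
  have "(\<integral>\<^sup>+t\<in>{x..y}. ennreal (1 / t) \<partial>lborel) = ennreal (ln y - ln x)"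
    by (rule nn_integral_FTC_Icc) (use assms in \<open>auto intro!: derivative_eq_intros\<close>)
  then show ?thesis using assms by (simp add: ln_div)
qed

text \<open>Turns Jensen's logarithmic sum into a bound for the integral of \<open>n(t)/t\<close>,
  where \<open>n\<close> counts the \<open>\<rho> k\<close> up to \<open>t\<close>: a single point
  contributes at most the integral of \<open>1/t\<close> from \<open>\<rho> k\<close> to
  \<open>T\<close>.\<close>

lemma nn_integral_counting_le:
  assumes F: "finite F" and \<rho>: "\<And>k. k \<in> F \<Longrightarrow> 0 < \<rho> k"
    and le: "(\<Sum>k | k \<in> F \<and> \<rho> k \<le> T. ln (T / \<rho> k)) \<le> B"
  shows "(\<integral>\<^sup>+t\<in>{x..T}. (\<Sum>k\<in>F. ennreal (1 / t) * indicator {\<rho> k..} t) \<partial>lborel) \<le> ennreal B"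
proof -
  have "(\<integral>\<^sup>+t\<in>{x..T}. (\<Sum>k\<in>F. ennreal (1 / t) * indicator {\<rho> k..} t) \<partial>lborel)
      = (\<Sum>k\<in>F. \<integral>\<^sup>+t. ennreal (1 / t) * indicator {\<rho> k..} t * indicator {x..T} t \<partial>lborel)"
    by (simp add: sum_distrib_right nn_integral_sum)
  also have "\<dots> \<le> (\<Sum>k\<in>F. if \<rho> k \<le> T then ennreal (ln (T / \<rho> k)) else 0)"
  proof (rule sum_mono)
    fix k assume "k \<in> F"
    have "(\<integral>\<^sup>+t. ennreal (1 / t) * indicator {\<rho> k..} t * indicator {x..T} t \<partial>lborel)
        \<le> (\<integral>\<^sup>+t\<in>{\<rho> k..T}. ennreal (1 / t) \<partial>lborel)"
      by (rule nn_integral_mono) (auto simp: indicator_def)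
    also have "\<dots> = (if \<rho> k \<le> T then ennreal (ln (T / \<rho> k)) else 0)"
      using nn_integral_inverse_Icc[OF \<rho>[OF \<open>k \<in> F\<close>]] by simp
    finally show "(\<integral>\<^sup>+t. ennreal (1 / t) * indicator {\<rho> k..} t * indicator {x..T} t \<partial>lborel)
        \<le> (if \<rho> k \<le> T then ennreal (ln (T / \<rho> k)) else 0)" .
  qed
  also have "\<dots> = (\<Sum>k | k \<in> F \<and> \<rho> k \<le> T. ennreal (ln (T / \<rho> k)))"
    using F by (simp add: sum.inter_filter)
  also have "\<dots> = ennreal (\<Sum>k | k \<in> F \<and> \<rho> k \<le> T. ln (T / \<rho> k))"
    using \<rho> by (intro sum_ennreal) (auto intro!: ln_ge_zero simp: divide_simps)
  also have "\<dots> \<le> ennreal B"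
    by (rule ennreal_leI[OF le])
  finally show ?thesis .
qed

text \<open>On \<open>{x..y}\<close> the weight is at least \<open>\<delta> y\<close>, so its
  logarithmic integral is at least \<open>\<delta> y * ln (y / x)\<close>.\<close>

lemma antimono_bound_of_log_integral:
  fixes \<delta> :: "real \<Rightarrow> real"
  assumes "0 < x" "x < y" "0 \<le> b" and anti: "antimono \<delta>" and nonneg: "\<And>t. 0 \<le> \<delta> t"
    and int: "(\<integral>\<^sup>+t\<in>{x..}. ennreal (\<delta> t / t) \<partial>lborel) \<le> ennreal b"
  shows "\<delta> y \<le> b / ln (y / x)"
proof -
  have "ennreal (\<delta> y * ln (y / x)) = ennreal (\<delta> y) * (\<integral>\<^sup>+t\<in>{x..y}. ennreal (1 / t) \<partial>lborel)"
    using assms by (simp add: nn_integral_inverse_Icc ennreal_mult' nonneg)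
  also have "\<dots> = (\<integral>\<^sup>+t. ennreal (\<delta> y) * (ennreal (1 / t) * indicator {x..y} t) \<partial>lborel)"
    by (rule nn_integral_cmult[symmetric]) simp
  also have "\<dots> \<le> (\<integral>\<^sup>+t\<in>{x..}. ennreal (\<delta> t / t) \<partial>lborel)"
  proof (rule nn_integral_mono)
    fix t
    show "ennreal (\<delta> y) * (ennreal (1 / t) * indicator {x..y} t) \<le> ennreal (\<delta> t / t) * indicator {x..} t"
    proof (cases "x \<le> t \<and> t \<le> y")
      case True
      then have "\<delta> y / t \<le> \<delta> t / t"
        using antimonoD[OF anti, of t y] \<open>0 < x\<close> by (intro divide_right_mono) auto
      then have "ennreal (\<delta> y) * ennreal (1 / t) \<le> ennreal (\<delta> t / t)"
        using nonneg[of y] by (simp flip: ennreal_mult' add: ennreal_leI)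
      with True show ?thesis by simp
    qed auto
  qed
  also note int
  finally have "\<delta> y * ln (y / x) \<le> b"
    using \<open>0 \<le> b\<close> by simp
  then show ?thesis
    using assms by (simp add: pos_le_divide_eq)
qed

section \<open>The estimate for finitely many zeros\<close>

text \<open>The bound is independent of \<open>F\<close>, which permits the later passage to
  infinitely many zeros. The factor 2 in the constant collects two equal bounds, one from
  \<open>{R0..2 * R0}\<close> and one from the left end of \<open>{2 * R0..}\<close>.\<close>

lemma finite_zero_sum_le:
  fixes \<delta> :: "real \<Rightarrow> real" and z :: "'i \<Rightarrow> complex"
  assumes R0: "0 < R0" and b: "0 \<le> b" and m: "admissible_majorant R0 m"
    and f: "f holomorphic_on UNIV" "f 0 \<noteq> 0"
    and bound: "\<And>w. R0 \<le> norm w \<Longrightarrow> norm (f w) \<le> exp (m (norm w))"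
    and F: "finite F" and outside: "\<And>k. k \<in> F \<Longrightarrow> R0 \<le> norm (z k)"
    and mult: "\<And>p. int (card {k \<in> F. z k = p}) \<le> zorder f p"
    and anti: "antimono \<delta>" and nonneg: "\<And>t. 0 \<le> \<delta> t"
    and int: "(\<integral>\<^sup>+t\<in>{R0..}. ennreal (\<delta> t / t) \<partial>lborel) \<le> ennreal b"
  shows "(\<Sum>k\<in>F. \<integral>\<^sup>+t\<in>{norm (z k)..}. ennreal (\<delta> t / t) \<partial>lborel)
    \<le> (\<integral>\<^sup>+t\<in>{R0..}. ennreal (\<delta> t * right_deriv m t) \<partial>lborel)
      + ennreal (2 * b / ln 2 * (m (4 * R0) - ln (norm (f 0))))"
proof -
  define L where "L = ln (norm (f 0))"
  define \<rho> where "\<rho> k = norm (z k)" for k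
  have \<rho>: "R0 \<le> \<rho> k" "0 < \<rho> k" if "k \<in> F" for k
    using outside[OF that] R0 by (auto simp: \<rho>_def)
  have jensen: "(\<Sum>k\<in>E. ln (r / \<rho> k)) \<le> m r - L"
    if "E \<subseteq> F" "R0 \<le> r" "\<And>k. k \<in> E \<Longrightarrow> \<rho> k \<le> r" for E r
    unfolding L_def \<rho>_def
  proof (rule jensen_inequality[OF finite_subset[OF that(1) F] f])
    fix p
    have "card {k \<in> E. z k = p} \<le> card {k \<in> F. z k = p}"
      using F that(1) by (intro card_mono) auto
    then show "int (card {k \<in> E. z k = p}) \<le> zorder f p"
      using mult[of p] by linarith
  qed (use that R0 bound in \<open>auto simp: \<rho>_def\<close>)
  have m_mono: "m s \<le> m t" if "R0 \<le> s" "s \<le> t" for s t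
    using m that by (auto simp: admissible_majorant_def mono_on_def)
  \<comment> \<open>The empty family reduces Jensen's inequality to \<open>L \<le> m r\<close>.
    These signs matter because \<open>ennreal\<close> sends negative reals to 0.\<close>
  have L2: "L \<le> m (2 * R0)" and L4: "L \<le> m (4 * R0)"
    using jensen[of "{}" "2 * R0"] jensen[of "{}" "4 * R0"] R0 by auto
  have "mono (\<lambda>t. - \<delta> t)"
    using anti by (auto simp: antimono_def mono_def)
  then have "(\<lambda>t. - (- \<delta> t)) \<in> borel_measurable borel"
    by (intro borel_measurable_uminus borel_measurable_mono)
  then have [measurable]: "\<delta> \<in> borel_measurable borel"
    by simp
  note [measurable] = admissible_right_deriv_measurable[OF R0 m]
  \<comment> \<open>This is \<open>n(t)/t\<close> for the counting function \<open>n\<close> of the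
    family.\<close>
  define a where "a t = (\<Sum>k\<in>F. ennreal (1 / t) * indicator {\<rho> k..} t)" for t
  have [measurable]: "a \<in> borel_measurable borel"
    unfolding a_def by measurable
  have split_weight: "ennreal (\<delta> t / t) = ennreal (\<delta> t) * ennreal (1 / t)" for t
    using nonneg[of t] by (simp flip: ennreal_mult')

  have "(\<Sum>k\<in>F. \<integral>\<^sup>+t\<in>{\<rho> k..}. ennreal (\<delta> t / t) \<partial>lborel)
      = (\<integral>\<^sup>+t. (\<Sum>k\<in>F. ennreal (\<delta> t / t) * indicator {\<rho> k..} t) \<partial>lborel)"
    by (rule nn_integral_sum[symmetric]) simp
  \<comment> \<open>The two ranges share the point \<open>2 * R0\<close>, which is harmless for an
    upper bound; below \<open>R0\<close> the counting function vanishes.\<close>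
  also have "\<dots> \<le> (\<integral>\<^sup>+t. ennreal (\<delta> t) * a t * indicator {R0..2 * R0} t
      + ennreal (\<delta> t) * a t * indicator {2 * R0..} t \<partial>lborel)"
  proof (rule nn_integral_mono)
    fix t
    have eq: "(\<Sum>k\<in>F. ennreal (\<delta> t / t) * indicator {\<rho> k..} t) = ennreal (\<delta> t) * a t"
      by (simp add: a_def split_weight sum_distrib_left mult.assoc)
    have "a t = 0" if "t < R0"
      unfolding a_def using \<rho>(1) that by (intro sum.neutral) (force simp: indicator_def)
    then show "(\<Sum>k\<in>F. ennreal (\<delta> t / t) * indicator {\<rho> k..} t)
        \<le> ennreal (\<delta> t) * a t * indicator {R0..2 * R0} t + ennreal (\<delta> t) * a t * indicator {2 * R0..} t"
      unfolding eq by (cases "t < R0"; cases "t \<le> 2 * R0") (auto simp: indicator_def)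
  qed
  also have "\<dots> = (\<integral>\<^sup>+t\<in>{R0..2 * R0}. ennreal (\<delta> t) * a t \<partial>lborel)
      + (\<integral>\<^sup>+t\<in>{2 * R0..}. ennreal (\<delta> t) * a t \<partial>lborel)"
    by (rule nn_integral_add) simp_all
  also have "(\<integral>\<^sup>+t\<in>{R0..2 * R0}. ennreal (\<delta> t) * a t \<partial>lborel) \<le> ennreal (b / ln 2 * (m (4 * R0) - L))"
  proof -
    define E where "E = {k \<in> F. \<rho> k \<le> 2 * R0}"
    have "finite E" using F by (simp add: E_def)
    have "(\<integral>\<^sup>+t\<in>{R0..2 * R0}. ennreal (\<delta> t) * a t \<partial>lborel)
        \<le> (\<integral>\<^sup>+t. ennreal (real (card E)) * (ennreal (\<delta> t / t) * indicator {R0..} t) \<partial>lborel)"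
    proof (rule nn_integral_mono)
      fix t
      show "ennreal (\<delta> t) * a t * indicator {R0..2 * R0} t
          \<le> ennreal (real (card E)) * (ennreal (\<delta> t / t) * indicator {R0..} t)"
      proof (cases "R0 \<le> t \<and> t \<le> 2 * R0")
        case True
        have "a t = (\<Sum>k\<in>E. ennreal (1 / t) * indicator {\<rho> k..} t)"
          unfolding a_def E_def using F True by (intro sum.mono_neutral_right) (auto simp: indicator_def split: if_splits)
        also have "\<dots> \<le> (\<Sum>k\<in>E. ennreal (1 / t))"
          by (intro sum_mono) (auto simp: indicator_def)
        also have "\<dots> = ennreal (real (card E)) * ennreal (1 / t)"
          by (simp add: ennreal_of_nat_eq_real_of_nat)
        finally have "ennreal (\<delta> t) * a t \<le> ennreal (\<delta> t) * (ennreal (real (card E)) * ennreal (1 / t))"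
          by (intro mult_left_mono) auto
        with True show ?thesis
          by (simp add: split_weight mult_ac)
      qed auto
    qed
    also have "\<dots> = ennreal (real (card E)) * (\<integral>\<^sup>+t\<in>{R0..}. ennreal (\<delta> t / t) \<partial>lborel)"
      by (rule nn_integral_cmult) simp
    also have "\<dots> \<le> ennreal (real (card E)) * ennreal b"
      by (intro mult_left_mono int) simp
    also have "\<dots> = ennreal (real (card E) * b)"
      by (simp add: ennreal_mult')
    also have "\<dots> \<le> ennreal (b / ln 2 * (m (4 * R0) - L))"
    proof (rule ennreal_leI)
      \<comment> \<open>Doubling the radius to \<open>4 * R0\<close> gives every point of
        \<open>E\<close> a ratio of at least 2, hence a share of at least \<open>ln 2\<close> in
        Jensen's sum.\<close>
      have "real (card E) * ln 2 = (\<Sum>k\<in>E. ln 2)"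
        by simp
      also have "\<dots> \<le> (\<Sum>k\<in>E. ln (4 * R0 / \<rho> k))"
        using \<rho> R0 by (intro sum_mono ln_mono) (auto simp: E_def field_simps)
      also have "\<dots> \<le> m (4 * R0) - L"
        using R0 by (intro jensen) (auto simp: E_def)
      finally have "real (card E) \<le> (m (4 * R0) - L) / ln 2"
        by (simp add: pos_le_divide_eq)
      from mult_left_mono[OF this b] show "real (card E) * b \<le> b / ln 2 * (m (4 * R0) - L)"
        by (simp add: mult.commute)
    qed
    finally show ?thesis .
  qed
  also have "(\<integral>\<^sup>+t\<in>{2 * R0..}. ennreal (\<delta> t) * a t \<partial>lborel)
      \<le> (\<integral>\<^sup>+t\<in>{R0..}. ennreal (\<delta> t * right_deriv m t) \<partial>lborel) + ennreal (b / ln 2 * (m (4 * R0) - L))"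
  proof -
    let ?c = "\<lambda>t. ennreal (right_deriv m (max t R0))"
    have "(\<integral>\<^sup>+t\<in>{2 * R0..}. ennreal (\<delta> t) * a t \<partial>lborel)
        \<le> (\<integral>\<^sup>+t\<in>{2 * R0..}. ennreal (\<delta> t) * ?c t \<partial>lborel)
          + ennreal (\<delta> (2 * R0)) * ennreal (m (2 * R0) - L)"
    proof (rule nn_integral_antimono_weight_le)
      fix T assume T: "2 * R0 \<le> T"
      have "(\<integral>\<^sup>+t\<in>{2 * R0..T}. a t \<partial>lborel) \<le> ennreal (m T - L)"
        unfolding a_def using R0 T \<rho> by (intro nn_integral_counting_le F jensen) auto
      \<comment> \<open>The increment of \<open>m\<close> becomes the integral of its right
        derivative; the rest is independent of \<open>T\<close> and serves as
        \<open>K\<close>.\<close>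
      also have "\<dots> = ennreal (m T - m (2 * R0)) + ennreal (m (2 * R0) - L)"
        using L2 m_mono[of "2 * R0" T] T R0 by (simp flip: ennreal_plus)
      also have "ennreal (m T - m (2 * R0)) \<le> (\<integral>\<^sup>+t\<in>{2 * R0..T}. ennreal (right_deriv m t) \<partial>lborel)"
        using R0 T by (intro admissible_increment_le_integral[OF R0 m]) auto
      also have "\<dots> = (\<integral>\<^sup>+t\<in>{2 * R0..T}. ?c t \<partial>lborel)"
        using R0 by (intro nn_integral_cong) (auto simp: indicator_def max.absorb1)
      finally show "(\<integral>\<^sup>+t\<in>{2 * R0..T}. a t \<partial>lborel)
          \<le> (\<integral>\<^sup>+t\<in>{2 * R0..T}. ?c t \<partial>lborel) + ennreal (m (2 * R0) - L)"
        by (simp add: add_right_mono)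
    qed (use anti nonneg in \<open>auto simp: monotone_on_def\<close>)
    also have "(\<integral>\<^sup>+t\<in>{2 * R0..}. ennreal (\<delta> t) * ?c t \<partial>lborel)
        \<le> (\<integral>\<^sup>+t\<in>{R0..}. ennreal (\<delta> t * right_deriv m t) \<partial>lborel)"
      using R0 by (intro nn_integral_mono)
        (auto simp: indicator_def max.absorb1 ennreal_mult' nonneg)
    also have "ennreal (\<delta> (2 * R0)) * ennreal (m (2 * R0) - L) \<le> ennreal (b / ln 2 * (m (4 * R0) - L))"
    proof -
      have "\<delta> (2 * R0) \<le> b / ln (2 * R0 / R0)"
        using R0 by (intro antimono_bound_of_log_integral[OF _ _ b anti nonneg int]) auto
      then have "\<delta> (2 * R0) * (m (2 * R0) - L) \<le> b / ln 2 * (m (4 * R0) - L)"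
        using R0 b L2 m_mono[of "2 * R0" "4 * R0"] by (intro mult_mono) auto
      then show ?thesis
        using nonneg by (simp flip: ennreal_mult' add: ennreal_leI)
    qed
    finally show ?thesis
      by (simp add: add_mono)
  qed
  finally have "(\<Sum>k\<in>F. \<integral>\<^sup>+t\<in>{\<rho> k..}. ennreal (\<delta> t / t) \<partial>lborel)
      \<le> ennreal (b / ln 2 * (m (4 * R0) - L)) +
        ((\<integral>\<^sup>+t\<in>{R0..}. ennreal (\<delta> t * right_deriv m t) \<partial>lborel) + ennreal (b / ln 2 * (m (4 * R0) - L)))"
    by (simp add: add_mono)
  also have "\<dots> = (\<integral>\<^sup>+t\<in>{R0..}. ennreal (\<delta> t * right_deriv m t) \<partial>lborel)
      + (ennreal (b / ln 2 * (m (4 * R0) - L)) + ennreal (b / ln 2 * (m (4 * R0) - L)))"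
    by (simp add: add_ac)
  also have "ennreal (b / ln 2 * (m (4 * R0) - L)) + ennreal (b / ln 2 * (m (4 * R0) - L))
      = ennreal (b / ln 2 * (m (4 * R0) - L) + b / ln 2 * (m (4 * R0) - L))"
    using b L4 by (intro ennreal_plus[symmetric]) auto
  also have "b / ln 2 * (m (4 * R0) - L) + b / ln 2 * (m (4 * R0) - L) = 2 * b / ln 2 * (m (4 * R0) - L)"
    by simp
  finally show ?thesis
    by (simp add: L_def \<rho>_def)
qed

section \<open>Passage to the whole sequence of zeros\<close>

theorem mainTheorem8:
  fixes R0 b :: real
  assumes "0 < R0" and "0 \<le> b"
  shows "\<exists>C\<ge>0. \<exists>Cbar :: (real \<Rightarrow> real) \<Rightarrow> real.
    (\<forall>m. admissible_majorant R0 m \<longrightarrow> 0 \<le> Cbar m) \<and>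
    (\<forall>m1 m2. admissible_majorant R0 m1 \<longrightarrow> admissible_majorant R0 m2 \<longrightarrow>
       (\<forall>r\<ge>R0. m1 r = m2 r) \<longrightarrow> Cbar m1 = Cbar m2) \<and>
    (\<forall>m a. admissible_majorant R0 m \<longrightarrow> 0 \<le> a \<longrightarrow> Cbar (\<lambda>r. a * m r) = a * Cbar m) \<and>
    (\<forall>m1 m2. admissible_majorant R0 m1 \<longrightarrow> admissible_majorant R0 m2 \<longrightarrow>
       Cbar (\<lambda>r. m1 r + m2 r) \<le> Cbar m1 + Cbar m2) \<and>
    (\<forall>m f N z d.
       admissible_majorant R0 m \<longrightarrow>
       f holomorphic_on UNIV \<longrightarrow>
       (\<exists>w. f w \<noteq> 0) \<longrightarrow>
       vanishes_on f N z \<longrightarrow>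
       (\<forall>w. R0 \<le> norm w \<longrightarrow> log_abs (f w) \<le> ereal (m (norm w))) \<longrightarrow>
       d \<in> decr_pos R0 b \<longrightarrow>
       enn2ereal (zero_sum R0 N z d) \<le>
         (if f 0 = 0 then \<infinity>
          else enn2ereal (growth_integral R0 m d) + ereal (C * Cbar m - C * ln (norm (f 0)))))"
proof -
  define C where "C = 2 * b / ln 2"
  \<comment> \<open>The positive part is homogeneous for nonnegative factors and subadditive. Only
    one value of \<open>m\<close> is read, at a point of \<open>{R0..}\<close>, so the arbitrary
    values below \<open>R0\<close> have no influence.\<close>
  define Cbar :: "(real \<Rightarrow> real) \<Rightarrow> real" where "Cbar m = max 0 (m (4 * R0))" for m
  have C: "0 \<le> C"
    using assms by (simp add: C_def)
  have main: "enn2ereal (zero_sum R0 N z d) \<le>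
      enn2ereal (growth_integral R0 m d) + ereal (C * Cbar m - C * ln (norm (f 0)))"
    if m: "admissible_majorant R0 m" and hol: "f holomorphic_on UNIV" and van: "vanishes_on f N z"
      and log: "\<forall>w. R0 \<le> norm w \<longrightarrow> log_abs (f w) \<le> ereal (m (norm w))"
      and d: "d \<in> decr_pos R0 b" and f0: "f 0 \<noteq> 0" for m f N z d
  proof -
    \<comment> \<open>Freezing \<open>d\<close> to the left of \<open>R0\<close> gives a nonnegative
      decreasing function on the whole line; \<open>Rd < R0\<close> keeps all arguments in the range
      where \<open>d\<close> is controlled.\<close>
    define \<delta> where "\<delta> t = d (ereal (max R0 t))" for t
    obtain Rd where Rd: "0 < Rd" "Rd < R0" and pos: "\<forall>t\<in>{ereal Rd..\<infinity>}. 0 \<le> d t"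
      and anti: "antimono_on {ereal Rd..\<infinity>} d"
      and int: "(\<integral>\<^sup>+t\<in>{R0..}. ennreal (d (ereal t) / t) \<partial>lborel) \<le> ennreal b"
      using d by (auto simp: decr_pos_def)
    have \<delta>_anti: "antimono \<delta>"
      unfolding \<delta>_def using Rd
      by (intro antimonoI monotone_onD[OF anti]) (auto simp del: ereal_max simp: le_max_iff_disj max.coboundedI2)
    have \<delta>_pos: "0 \<le> \<delta> t" for t
      unfolding \<delta>_def using Rd by (intro pos[rule_format]) (auto simp: le_max_iff_disj)
    have \<delta>_eq: "\<delta> t = d (ereal t)" if "R0 \<le> t" for t
      using that by (simp add: \<delta>_def max.absorb2)
    have \<delta>_int: "(\<integral>\<^sup>+t\<in>{R0..}. ennreal (\<delta> t / t) \<partial>lborel) \<le> ennreal b"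
      using int by (rule back_subst[of "\<lambda>x. x \<le> ennreal b"])
        (auto intro!: nn_integral_cong simp: indicator_def \<delta>_eq)
    \<comment> \<open>The exponential form also covers zeros of \<open>f\<close>, where
      \<open>log_abs\<close> is minus infinity but \<open>ln\<close> would give 0.\<close>
    have bound: "norm (f w) \<le> exp (m (norm w))" if "R0 \<le> norm w" for w
    proof (cases "f w = 0")
      case False
      then have "ln (norm (f w)) \<le> m (norm w)"
        using log that by (auto simp: log_abs_def)
      then show ?thesis
        using False by (metis exp_le_cancel_iff exp_ln zero_less_norm_iff)
    qed simp
    \<comment> \<open>In \<open>ennreal\<close> the sum is the supremum of its finite partial sums,
      and each of these obeys the same bound.\<close>
    have "zero_sum R0 N z d \<le> growth_integral R0 m d + ennreal (C * (m (4 * R0) - ln (norm (f 0))))"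
      unfolding zero_sum_def nonneg_infsum_complete[OF zero_le]
    proof (rule SUP_least, clarify)
      fix F assume F: "finite F" "F \<subseteq> {k \<in> seq_index N. R0 \<le> norm (z k)}"
      have mult: "int (card {k \<in> F. z k = p}) \<le> zorder f p" for p
      proof -
        have "card {k \<in> F. z k = p} \<le> card {k \<in> seq_index N. z k = p}"
          using van F(2) by (intro card_mono) (auto simp: vanishes_on_def)
        moreover have "int (card {k \<in> seq_index N. z k = p}) \<le> zorder f p"
          using van by (simp add: vanishes_on_def)
        ultimately show ?thesis by linarith
      qed
      have "(\<Sum>k\<in>F. \<integral>\<^sup>+t\<in>{norm (z k)..}. ennreal (d (ereal t) / t) \<partial>lborel)
          = (\<Sum>k\<in>F. \<integral>\<^sup>+t\<in>{norm (z k)..}. ennreal (\<delta> t / t) \<partial>lborel)"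
        using F(2) by (intro sum.cong refl nn_integral_cong) (auto simp: indicator_def \<delta>_eq)
      also have "\<dots> \<le> (\<integral>\<^sup>+t\<in>{R0..}. ennreal (\<delta> t * right_deriv m t) \<partial>lborel)
          + ennreal (2 * b / ln 2 * (m (4 * R0) - ln (norm (f 0))))"
        by (rule finite_zero_sum_le[OF assms m hol f0 bound F(1) _ mult \<delta>_anti \<delta>_pos \<delta>_int])
          (use F(2) in auto)
      also have "(\<integral>\<^sup>+t\<in>{R0..}. ennreal (\<delta> t * right_deriv m t) \<partial>lborel) = growth_integral R0 m d"
        unfolding growth_integral_def
        by (intro nn_integral_cong) (auto simp: indicator_def \<delta>_eq)
      finally show "(\<Sum>k\<in>F. \<integral>\<^sup>+t\<in>{norm (z k)..}. ennreal (d (ereal t) / t) \<partial>lborel)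
          \<le> growth_integral R0 m d + ennreal (C * (m (4 * R0) - ln (norm (f 0))))"
        by (simp add: C_def)
    qed
    \<comment> \<open>This sign ensures that \<open>ennreal\<close> does not truncate the constant,
      so it can be read as a real number again in \<open>ereal\<close>. It is Jensen's inequality
      with no zeros.\<close>
    moreover have "0 \<le> m (4 * R0) - ln (norm (f 0))"
    proof -
      have "0 \<le> zorder f p" for p
        using van by (auto simp: vanishes_on_def intro: order_trans[OF of_nat_0_le_iff])
      moreover have "norm (f w) \<le> exp (m (4 * R0))" if "norm w = 4 * R0" for w
        using bound[of w] that assms(1) by simp
      ultimately show ?thesis
        using jensen_inequality[of "{}" f z "4 * R0" "m (4 * R0)"] hol f0 assms(1) by simp
    qed
    moreover have "C * (m (4 * R0) - ln (norm (f 0))) \<le> C * Cbar m - C * ln (norm (f 0))"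
      using C by (simp add: Cbar_def flip: right_diff_distrib) (intro mult_left_mono; simp)
    ultimately have "enn2ereal (zero_sum R0 N z d)
        \<le> enn2ereal (growth_integral R0 m d) + ereal (C * (m (4 * R0) - ln (norm (f 0))))"
      using C by (simp add: less_eq_ennreal.rep_eq plus_ennreal.rep_eq enn2ereal_ennreal)
    also have "\<dots> \<le> enn2ereal (growth_integral R0 m d) + ereal (C * Cbar m - C * ln (norm (f 0)))"
      by (intro add_left_mono) (simp add: \<open>C * (m (4 * R0) - ln (norm (f 0))) \<le> C * Cbar m - C * ln (norm (f 0))\<close>)
    finally show ?thesis .
  qed
  show ?thesis
  proof (intro exI[of _ C] exI[of _ Cbar] conjI allI impI)
    show "Cbar (\<lambda>r. a * m r) = a * Cbar m" if "0 \<le> a" for m a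
      using that by (simp add: Cbar_def max_mult_distrib_left)
  qed (use C main assms in \<open>auto simp: Cbar_def\<close>)
qed

end
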